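(* Let $r$ and $s$ be fixed positive integers. Then there are constants $c>0$ and $C>0$ (depending on $r,s$) such that for all sufficiently large positive integers $k$ divisible by $r+s$, $$c\,k^{1.475}\le M(r,s,k)\le \frac{rs}{(r+s)^2}k^2+Ck.$$
   Context: For a positive integer $n$, $[n]=\{1,\ldots,n\}$; for $f:[n]\to\mathbb Z$ and $Y\subseteq[n]$, $f(Y)=\sum_{y\in Y}f(y)$. A $k$-term arithmetic progression in $[n]$ is a set $\{a,a+d,\ldots,a+(k-1)d\}\subseteq[n]$ with $d$ a positive integer. For positive integers $r,s,k$ with $r+s\mid k$, $M(r,s,k)$ is the minimum value such that for every $n\ge M(r,s,k)$ and every $f:[n]\to\{-r,s\}$ with $f([n])=0$, there is a $k$-term arithmetic progression $A\subseteq[n]$ with $f(A)=0$. *)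

theory Defs
  imports Complex_Main "HOL-Library.FuncSet" "HOL-Library.Extended_Real"
begin

definition is_AP :: "nat \<Rightarrow> nat \<Rightarrow> nat set \<Rightarrow> bool" where
  "is_AP k n A \<longleftrightarrow> A \<subseteq> {1..n} \<and> (\<exists>a d. d > 0 \<and> A = {a + i * d | i. i < k})"

definition forces_zero_sum_AP :: "nat \<Rightarrow> nat \<Rightarrow> nat \<Rightarrow> nat \<Rightarrow> bool" where
  "forces_zero_sum_AP r s k n \<longleftrightarrow>
     (\<forall>f :: nat \<Rightarrow> int. f \<in> {1..n} \<rightarrow> {- int r, int s} \<and> sum f {1..n} = 0 \<longrightarrow>
        (\<exists>A. is_AP k n A \<and> sum f A = 0))"

text \<open>The minimum is taken in the extended naturals, so that it is \<open>\<infinity>\<close> if no threshold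
  exists; an upper bound on it therefore includes the existence of a threshold.\<close>

definition M :: "nat \<Rightarrow> nat \<Rightarrow> nat \<Rightarrow> enat" where
  "M r s k = Inf {enat m | m. m > 0 \<and> (\<forall>n\<ge>m. forces_zero_sum_AP r s k n)}"

end

theory Submission
  imports Defs
begin

text \<open>
  Upper bound: progressions with difference \<open>1\<close> suffice. Sums over \<open>k\<close> consecutive integers are
  multiples of \<open>r + s\<close> and change by at most \<open>r + s\<close> under a shift by one, so if none vanishes they
  all have the same sign, say positive. If \<open>n = q k + m\<close> with \<open>m < k\<close>, then the last \<open>m\<close> values
  sum up to at most \<open>- q (r + s)\<close>, while the last \<open>k\<close> values have positive sum; this forces
  \<open>q (r + s)\<^sup>2 < r s k\<close>.

  Lower bound: colour \<open>k\<close>-periodically, each period consisting of \<open>R\<close> values \<open>- r\<close> followed by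
  \<open>k - R\<close> values \<open>s\<close>. A \<open>k\<close>-term progression with difference \<open>d\<close> runs \<open>g = gcd d k\<close> times through a
  residue class modulo \<open>g\<close>, hence takes the value \<open>- r\<close> fewer than \<open>R + g\<close> times. With
  \<open>R = s k / (r + s) - D\<close>, where \<open>D\<close> exceeds all possible differences, every progression
  has positive sum. One period has sum \<open>(r + s) D\<close>, so about \<open>k / D\<close> periods can be
  compensated by a final run of values \<open>- r\<close>. Balancing \<open>D\<close> with the number of periods gives length of
  order \<open>k powr (3/2)\<close>, which is more than needed.
\<close>

section \<open>Upper bound: zero-sum blocks of consecutive integers\<close>

lemma dvd_sum_two_valued:
  fixes f :: "nat \<Rightarrow> int"
  assumes "\<And>x. x \<in> A \<Longrightarrow> f x \<in> {- int r, int s}" and "(r + s) dvd card A"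
  shows "int (r + s) dvd sum f A"
proof -
  \<comment> \<open>Adding \<open>r\<close> turns the two values into \<open>0\<close> and
    \<open>r + s\<close>.\<close>
  have "int (r + s) dvd (\<Sum>x\<in>A. f x + int r)"
  proof (rule dvd_sum)
    show "int (r + s) dvd f x + int r" if "x \<in> A" for x
      using assms(1)[OF that] by (auto simp: add.commute)
  qed
  moreover have "int (r + s) dvd int (card A) * int r"
    using assms(2) by (simp add: int_dvd_int_iff del: of_nat_add)
  moreover have "sum f A = (\<Sum>x\<in>A. f x + int r) - int (card A) * int r"
    by (simp add: sum.distrib)
  ultimately show ?thesis by (metis dvd_diff)
qed

text \<open>A shift by one lowers the sum by at most \<open>r + s\<close>, so a window with sum at
  least \<open>r + s\<close> is followed by one with nonnegative sum; nonvanishing and divisibility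
  lift this back to \<open>r + s\<close>.\<close>

lemma window_sum_ge:
  fixes f :: "nat \<Rightarrow> int"
  assumes f: "\<And>x. x \<in> {1..n} \<Longrightarrow> f x \<in> {- int r, int s}"
    and k: "(r + s) dvd k"
    and nonzero: "\<And>a. a + k \<le> n \<Longrightarrow> sum f {a<..a + k} \<noteq> 0"
    and pos: "sum f {0<..k} > 0"
    and a: "a + k \<le> n"
  shows "int (r + s) \<le> sum f {a<..a + k}"
proof -
  have ge: "int (r + s) \<le> sum f {b<..b + k}" if "b + k \<le> n" "sum f {b<..b + k} \<ge> 0" for b
  proof -
    have "int (r + s) dvd sum f {b<..b + k}"
      by (rule dvd_sum_two_valued) (use f k that in auto)
    moreover have "sum f {b<..b + k} > 0" using nonzero[OF that(1)] that(2) by simp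
    ultimately show ?thesis by (rule zdvd_imp_le)
  qed
  show ?thesis using a
  proof (induction a)
    case 0
    then show ?case using ge[of 0] pos by simp
  next
    case (Suc a)
    have "k > 0" using pos by (cases k) auto
    \<comment> \<open>Both sides are the union of the two overlapping windows.\<close>
    have "insert (Suc a) {Suc a<..Suc a + k} = insert (Suc (a + k)) {a<..a + k}"
      using \<open>k > 0\<close> by auto
    then have "sum f (insert (Suc a) {Suc a<..Suc a + k}) = sum f (insert (Suc (a + k)) {a<..a + k})"
      by simp
    then have "f (Suc a) + sum f {Suc a<..Suc a + k} = f (Suc (a + k)) + sum f {a<..a + k}"
      by simp
    moreover have "f (Suc a) \<le> int s" using f[of "Suc a"] Suc.prems by auto
    moreover have "f (Suc (a + k)) \<ge> - int r" using f[of "Suc (a + k)"] Suc.prems by auto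
    ultimately have "sum f {Suc a<..Suc a + k} \<ge> 0" using Suc.IH Suc.prems by simp
    then show ?case using ge[of "Suc a"] Suc.prems by simp
  qed
qed

lemma balanced_length_less:
  fixes f :: "nat \<Rightarrow> int"
  assumes rs: "r > 0" "s > 0"
    and f: "\<And>x. x \<in> {1..n} \<Longrightarrow> f x \<in> {- int r, int s}"
    and k: "k = (r + s) * K"
    and nonzero: "\<And>a. a + k \<le> n \<Longrightarrow> sum f {a<..a + k} \<noteq> 0"
    and pos: "sum f {0<..k} > 0"
    and balanced: "sum f {1..n} = 0"
    and "k \<le> n"
  shows "n < r * s * K\<^sup>2 + k"
proof -
  define q m where "q = n div k" and "m = n mod k"
  have n: "n = q * k + m" by (simp add: q_def m_def)
  have "k > 0" using pos by (cases k) auto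
  then have "m < k" by (simp add: m_def)
  have window: "int (r + s) \<le> sum f {a<..a + k}" if "a + k \<le> n" for a
    by (rule window_sum_ge[of n f r s k a]) (use f k nonzero pos that in auto)
  have split: "sum f {0<..b} + sum f {b<..c} = sum f {0<..c}" if "b \<le> c" for b c
    using that by (subst sum.union_disjoint[symmetric]) (auto intro!: sum.cong)
  have periods: "int j * int (r + s) \<le> sum f {0<..j * k}" if "j \<le> q" for j
    using that
  proof (induction j)
    case (Suc j)
    have "Suc j * k \<le> n" using Suc.prems n by (metis mult_le_mono1 trans_le_add1)
    then have "int (r + s) \<le> sum f {j * k<..j * k + k}" by (intro window) simp
    moreover have "sum f {0<..j * k} + sum f {j * k<..j * k + k} = sum f {0<..j * k + k}"
      by (rule split) simp
    ultimately show ?case using Suc by (simp add: algebra_simps)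
  qed simp
  \<comment> \<open>Balance makes the tail \<open>T\<close> offset the \<open>q\<close> full
    windows. It has only \<open>m\<close> terms, each at least \<open>- r\<close>, which bounds
    \<open>q\<close> in terms of \<open>m\<close>.\<close>
  define T where "T = sum f {q * k<..n}"
  have "{1..n} = {0<..n}" by auto
  then have "sum f {0<..q * k} + T = 0"
    using split[of "q * k" n] balanced n by (simp add: T_def)
  then have T_le: "T \<le> - (int q * int (r + s))" using periods[of q] by simp
  have "- int r * int m \<le> T"
  proof -
    have "(\<Sum>x\<in>{q * k<..n}. - int r) \<le> T"
      unfolding T_def
    proof (rule sum_mono)
      show "- int r \<le> f x" if "x \<in> {q * k<..n}" for x using f[of x] that by auto
    qed
    then show ?thesis by (simp add: n mult.commute)
  qed
  then have 1: "int q * int (r + s) \<le> int r * int m" using T_le by simp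
  \<comment> \<open>The last window is positive although it contains the tail, so its other
    \<open>k - m\<close> terms, each at most \<open>s\<close>, must outweigh
    \<open>T\<close>.\<close>
  have "sum f {n - k<..n} = sum f {n - k<..q * k} + T"
    using n \<open>k \<le> n\<close> \<open>m < k\<close> unfolding T_def
    by (subst sum.union_disjoint[symmetric]) (auto intro!: sum.cong)
  moreover have "sum f {n - k<..q * k} \<le> (\<Sum>x\<in>{n - k<..q * k}. int s)"
  proof (rule sum_mono)
    show "f x \<le> int s" if "x \<in> {n - k<..q * k}" for x using f[of x] that n by auto
  qed
  moreover have "card {n - k<..q * k} = k - m"
    using n \<open>k \<le> n\<close> \<open>m < k\<close> by simp
  moreover have "int (r + s) \<le> sum f {n - k<..n}"
    using window[of "n - k"] \<open>k \<le> n\<close> by simp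
  ultimately have "int q * int (r + s) < int (k - m) * int s"
    using T_le rs by simp
  then have 2: "int q * int (r + s) < (int k - int m) * int s"
    using \<open>m < k\<close> by (simp add: of_nat_diff)
  \<comment> \<open>The weights \<open>s\<close> and \<open>r\<close> eliminate
    \<open>m\<close>.\<close>
  have "int s * (int q * int (r + s)) + int r * (int q * int (r + s))
      < int s * (int r * int m) + int r * ((int k - int m) * int s)"
    by (rule add_le_less_mono) (use 1 2 rs in \<open>auto intro: mult_left_mono mult_strict_left_mono\<close>)
  then have "int ((r + s) * (q * (r + s))) < int ((r + s) * (r * s * K))"
    by (simp add: k algebra_simps)
  then have "q * (r + s) < r * s * K" by (metis of_nat_less_iff mult_less_cancel1)
  then have "q * (r + s) * K \<le> r * s * K * K" by (intro mult_right_mono) auto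
  then show ?thesis using n \<open>m < k\<close> by (simp add: k power2_eq_square algebra_simps)
qed

lemma is_AP_iff_image:
  "is_AP k n A \<longleftrightarrow> A \<subseteq> {1..n} \<and> (\<exists>a d. d > 0 \<and> A = (\<lambda>i. a + i * d) ` {..<k})"
proof -
  have "{a + i * d | i. i < k} = (\<lambda>i. a + i * d) ` {..<k}" for a d :: nat by auto
  then show ?thesis by (simp only: is_AP_def)
qed

lemma forces_zero_sum_AP_if_large:
  assumes rs: "r > 0" "s > 0" and k: "k = (r + s) * K" and "K > 0"
    and n: "r * s * K\<^sup>2 + k \<le> n"
  shows "forces_zero_sum_AP r s k n"
  unfolding forces_zero_sum_AP_def
proof (intro allI impI, rule ccontr)
  fix f :: "nat \<Rightarrow> int"
  assume f: "f \<in> {1..n} \<rightarrow> {- int r, int s} \<and> sum f {1..n} = 0"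
    and no: "\<not> (\<exists>A. is_AP k n A \<and> sum f A = 0)"
  have nonzero: "sum f {a<..a + k} \<noteq> 0" if "a + k \<le> n" for a
  proof -
    have "{a<..a + k} = (\<lambda>i. Suc a + i * 1) ` {..<k}"
    proof (intro equalityI subsetI)
      fix x assume "x \<in> {a<..a + k}"
      then show "x \<in> (\<lambda>i. Suc a + i * 1) ` {..<k}"
        by (intro image_eqI[of _ _ "x - Suc a"]) auto
    qed auto
    moreover have "{a<..a + k} \<subseteq> {1..n}" using that by auto
    ultimately have "is_AP k n {a<..a + k}"
      unfolding is_AP_iff_image using zero_less_one by blast
    then show ?thesis using no by blast
  qed
  have "k \<le> n" using n by simp
  then consider "sum f {0<..k} > 0" | "sum f {0<..k} < 0"
    using nonzero[of 0] by fastforce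
  then show False
  proof cases
    case 1
    have "n < r * s * K\<^sup>2 + k"
      by (rule balanced_length_less[of r s n f k K]) (use 1 rs f k nonzero \<open>k \<le> n\<close> in auto)
    then show False using n by simp
  next
    case 2
    \<comment> \<open>Negating \<open>f\<close> exchanges \<open>r\<close> and \<open>s\<close>; the
      bound is symmetric in them.\<close>
    have "n < s * r * K\<^sup>2 + k"
    proof (rule balanced_length_less[of s r n "\<lambda>x. - f x" k K])
      show "- f x \<in> {- int s, int r}" if "x \<in> {1..n}" for x
      proof -
        have "f x \<in> {- int r, int s}" using f that by blast
        then show ?thesis by auto
      qed
    qed (use 2 rs f k nonzero \<open>k \<le> n\<close> in \<open>auto simp: sum_negf\<close>)
    then show False using n by (simp add: mult.commute)
  qed
qed

section \<open>Lower bound: a periodic colouring with a slight surplus\<close>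

text \<open>With \<open>g = gcd d k\<close>, the terms modulo \<open>k\<close> stay in one residue
  class modulo \<open>g\<close> and meet each of its elements \<open>g\<close> times. At most
  \<open>(R + g - 1) div g\<close> of these elements, the ceiling of \<open>R / g\<close>, lie below
  \<open>R\<close>.\<close>

lemma card_AP_mod_less:
  fixes a d k R :: nat
  assumes "k > 0" "d > 0"
  shows "card {i. i < k \<and> (a + i * d) mod k < R} < R + gcd d k"
proof -
  define g where "g = gcd d k"
  have "g > 0" using assms by (simp add: g_def)
  obtain d' k' where d: "d = d' * g" and k: "k = k' * g" and "coprime d' k'"
    using gcd_coprime_exists[of d k] \<open>g > 0\<close> unfolding g_def by auto
  have "k' > 0" using assms k by (cases k') auto
  define S where "S = {i. i < k \<and> (a + i * d) mod k < R}"
  \<comment> \<open>The first component gives the position in the residue class, the second says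
    which of the \<open>g\<close> traversals \<open>i\<close> belongs to.\<close>
  define h where "h i = ((a + i * d) mod k div g, i div k')" for i
  have mod_g: "(a + i * d) mod k mod g = a mod g" for i
    by (simp add: k d mod_mod_cancel mult.assoc[symmetric])
  have "inj_on h S"
  proof (rule inj_onI)
    fix i j assume "h i = h j"
    then have eq: "(a + i * d) mod k div g = (a + j * d) mod k div g" "i div k' = j div k'"
      by (auto simp: h_def)
    then have "(a + i * d) mod k = (a + j * d) mod k"
      using mod_g by (metis div_mod_decomp)
    then have "int k dvd int (a + i * d) - int (a + j * d)"
      by (metis mod_eq_dvd_iff zmod_int)
    then have "int k' * int g dvd (int i - int j) * int d' * int g"
      by (simp add: k d algebra_simps)
    then have "int k' dvd (int i - int j) * int d'" using \<open>g > 0\<close> by simp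
    then have "int k' dvd int i - int j"
      using \<open>coprime d' k'\<close> by (simp add: coprime_dvd_mult_left_iff coprime_commute)
    then have "i mod k' = j mod k'"
      by (metis mod_eq_dvd_iff zmod_int of_nat_eq_iff)
    then show "i = j" using eq(2) by (metis div_mod_decomp)
  qed
  moreover have "h ` S \<subseteq> {..<(R + g - 1) div g} \<times> {..<g}"
  proof -
    have "x div g < (R + g - 1) div g" if "x < R" for x
    proof -
      have "(x + g) div g \<le> (R + g - 1) div g" using that by (intro div_le_mono) simp
      then show ?thesis using \<open>g > 0\<close> by simp
    qed
    moreover have "i div k' < g" if "i < k" for i
      using that by (simp add: k less_mult_imp_div_less mult.commute)
    ultimately show ?thesis by (auto simp: h_def S_def)
  qed
  ultimately have "card S \<le> card ({..<(R + g - 1) div g} \<times> {..<g})"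
    by (intro card_inj_on_le) auto
  also have "\<dots> = (R + g - 1) div g * g" by simp
  also have "\<dots> \<le> R + g - 1" by (rule div_times_less_eq_dividend)
  also have "\<dots> < R + g" using \<open>g > 0\<close> by simp
  finally show ?thesis by (simp add: S_def g_def)
qed

lemma sum_two_valued:
  assumes "finite A"
  shows "(\<Sum>x\<in>A. if P x then - int r else int s)
    = int s * int (card A) - int (r + s) * int (card {x \<in> A. P x})"
proof -
  have "(\<Sum>x\<in>A. if P x then - int r else int s)
    = (\<Sum>x\<in>A. int s - int (r + s) * (if P x then 1 else 0))"
    by (intro sum.cong) auto
  also have "\<dots> = int s * int (card A) - int (r + s) * (\<Sum>x\<in>A. if P x then 1 else 0)"
    by (simp add: sum_subtractf sum_distrib_left)
  also have "(\<Sum>x\<in>A. if P x then 1 else 0) = int (card {x \<in> A. P x})"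
    using assms by (simp add: sum.If_cases Int_def)
  finally show ?thesis .
qed

lemma not_forces_zero_sum_AP:
  fixes t :: nat
  assumes k: "k = (r + s) * K" and "k > 0"
    and t: "t * (r + s) * (r * t + 2) + (r * t + 2) \<le> s * K"
  shows "\<exists>n \<ge> r * t * k. \<not> forces_zero_sum_AP r s k n"
proof -
  \<comment> \<open>There are \<open>r * t\<close> full periods with surplus
    \<open>(r + s) * D\<close> each; the factor \<open>r\<close> makes the number \<open>L\<close>
    of compensating values \<open>- r\<close> an integer. The assumption on \<open>t\<close> amounts
    to \<open>D + L \<le> s * K\<close>.\<close>
  define D R L n where "D = r * t + 2" and "R = s * K - D"
    and "L = t * (r + s) * D" and "n = r * t * k + L"
  have "D + L \<le> s * K" using t by (simp add: D_def L_def)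
  then have R: "R + D = s * K" "L \<le> R" by (auto simp: R_def)
  moreover have "s * K \<le> k" by (simp add: k)
  moreover have "D > 0" by (simp add: D_def)
  ultimately have "R < k" "L < k" "D \<le> k" by auto
  define p where "p y = (if y mod k < R then - int r else int s)" for y
  define f where "f x = p (x - 1)" for x
  have AP_pos: "sum f A > 0" if AP: "is_AP k n A" for A
  proof -
    obtain b d where d: "d > 0" and A: "A = (\<lambda>i. b + i * d) ` {..<k}"
      and An: "A \<subseteq> {1..n}"
      using AP unfolding is_AP_iff_image by blast
    have "b + 0 * d \<in> A" "b + (k - 1) * d \<in> A" unfolding A using \<open>k > 0\<close> by auto
    then have "1 \<le> b" "b + (k - 1) * d \<le> n" using An by auto
    then obtain a where b: "b = Suc a" by (cases b) auto
    \<comment> \<open>The summand \<open>2\<close> in \<open>D\<close> gives two spare multiples of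
      \<open>k\<close>: one exceeds \<open>L\<close>, the other absorbs the loss of \<open>D\<close>
      from having \<open>k - 1\<close> steps instead of \<open>k\<close>.\<close>
    have "d < D"
    proof (rule ccontr)
      assume "\<not> d < D"
      then have "(k - 1) * D \<le> (k - 1) * d" by simp
      then have "(k - 1) * D < n" using \<open>b + (k - 1) * d \<le> n\<close> \<open>1 \<le> b\<close> by linarith
      then have "k * D < n + D" using \<open>k > 0\<close> by (cases k) auto
      moreover have "k * D = r * t * k + k + k" by (simp add: D_def algebra_simps)
      ultimately show False using \<open>D \<le> k\<close> \<open>L < k\<close> by (simp add: n_def)
    qed
    have "inj_on (\<lambda>i. b + i * d) {..<k}" using d by (auto simp: inj_on_def)
    then have "sum f A = (\<Sum>i<k. p (a + i * d))"
      by (simp add: A sum.reindex f_def b)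
    also have "\<dots> = int s * int k - int (r + s) * int (card {i \<in> {..<k}. (a + i * d) mod k < R})"
      unfolding p_def by (subst sum_two_valued) auto
    finally have sum: "sum f A
      = int s * int k - int (r + s) * int (card {i \<in> {..<k}. (a + i * d) mod k < R})" .
    \<comment> \<open>A zero sum would require exactly \<open>s * K\<close> terms with value
      \<open>- r\<close>; there are fewer, because \<open>R + d < R + D = s * K\<close>.\<close>
    have "gcd d k \<le> d" using d by (simp add: gcd_le1_nat)
    then have "card {i. i < k \<and> (a + i * d) mod k < R} < s * K"
      using card_AP_mod_less[OF \<open>k > 0\<close> d, of a R] \<open>d < D\<close> R by linarith
    moreover have "r + s > 0" using \<open>k > 0\<close> k by auto
    ultimately have "(r + s) * card {i \<in> {..<k}. (a + i * d) mod k < R} < (r + s) * (s * K)"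
      by simp
    then have "int ((r + s) * card {i \<in> {..<k}. (a + i * d) mod k < R}) < int (s * k)"
      by (simp add: k mult.left_commute del: of_nat_mult)
    then show ?thesis unfolding sum by simp
  qed
  have period: "(\<Sum>y<k. p y) = int (r + s) * int D"
  proof -
    have "{y \<in> {..<k}. y mod k < R} = {..<R}" using \<open>R < k\<close> by auto
    then have "(\<Sum>y<k. p y) = int s * int k - int (r + s) * int R"
      unfolding p_def by (subst sum_two_valued) auto
    also have "\<dots> = int (r + s) * (int (s * K) - int R)" by (simp add: k algebra_simps)
    finally show ?thesis by (simp flip: R(1))
  qed
  have split: "(\<Sum>y<k + m. p y) = (\<Sum>y<k. p y) + (\<Sum>y<m. p (k + y))" for m
    by (induction m) simp_all
  have shift: "(\<Sum>y<j * k + m. p y) = int j * (int (r + s) * int D) + (\<Sum>y<m. p y)" for j m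
  proof (induction j)
    case (Suc j)
    have "(\<Sum>y<Suc j * k + m. p y) = (\<Sum>y<k + (j * k + m). p y)" by (simp add: add.assoc)
    also have "\<dots> = (\<Sum>y<k. p y) + (\<Sum>y<j * k + m. p (k + y))"
      by (rule split)
    also have "(\<Sum>y<j * k + m. p (k + y)) = (\<Sum>y<j * k + m. p y)" by (simp add: p_def)
    finally show ?case using Suc.IH period by (simp add: algebra_simps)
  qed simp
  \<comment> \<open>As \<open>L \<le> R\<close>, the compensating run is the start of the next
    period, so \<open>f\<close> follows \<open>p\<close> throughout.\<close>
  have "(\<Sum>y<L. p y) = (\<Sum>y<L. - int r)"
    by (rule sum.cong) (use R \<open>L < k\<close> in \<open>auto simp: p_def\<close>)
  then have "(\<Sum>y<n. p y) = 0"
    unfolding n_def shift by (simp add: L_def algebra_simps)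
  moreover have "sum f {1..n} = (\<Sum>y<n. p y)"
    by (rule sum.reindex_bij_witness[of _ Suc "\<lambda>x. x - 1"]) (auto simp: f_def)
  moreover have "f \<in> {1..n} \<rightarrow> {- int r, int s}" by (auto simp: f_def p_def)
  ultimately have "\<not> forces_zero_sum_AP r s k n"
    using AP_pos unfolding forces_zero_sum_AP_def by (metis less_irrefl)
  then show ?thesis by (intro exI[of _ n]) (simp add: n_def)
qed

section \<open>Bounds on the threshold and choice of constants\<close>

lemma M_le:
  assumes "m > 0" "\<And>n. n \<ge> m \<Longrightarrow> forces_zero_sum_AP r s k n"
  shows "M r s k \<le> enat m"
  unfolding M_def by (rule Inf_lower) (use assms in blast)

lemma M_ge:
  assumes "\<not> forces_zero_sum_AP r s k n"
  shows "enat n \<le> M r s k"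
  unfolding M_def
proof (rule Inf_greatest)
  fix x assume "x \<in> {enat m | m. m > 0 \<and> (\<forall>n\<ge>m. forces_zero_sum_AP r s k n)}"
  then obtain m where "x = enat m" "\<forall>n\<ge>m. forces_zero_sum_AP r s k n" by blast
  then show "enat n \<le> x" using assms by (cases "m \<le> n") auto
qed

text \<open>\<open>B\<close> is chosen so that \<open>B * t\<^sup>2 \<le> k\<close> implies the size
  condition on \<open>t\<close> in \<open>not_forces_zero_sum_AP\<close>; the largest such
  \<open>t\<close> has order \<open>sqrt k\<close>.\<close>

lemma M_lower_bound:
  fixes r s k :: nat
  defines "B \<equiv> (r + s) * (r + s + 1) * (r + 2)"
  assumes rs: "r > 0" "s > 0" and k: "(r + s) dvd k" and "B \<le> k"
  shows "ereal (real k powr 1.475 / (2 * sqrt B)) \<le> ereal_of_enat (M r s k)"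
proof -
  obtain K where K: "k = (r + s) * K" using k by auto
  have "B > 0" using rs by (simp add: B_def)
  then have "k \<ge> 1" using \<open>B \<le> k\<close> by simp
  define u where "u = sqrt (k / B)"
  define t where "t = nat \<lfloor>u\<rfloor>"
  have "u \<ge> 1" using \<open>B \<le> k\<close> \<open>B > 0\<close> by (simp add: u_def)
  \<comment> \<open>Rounding down a number that is at least \<open>1\<close> loses at most a factor
    \<open>2\<close>, whence the \<open>2\<close> in the constant.\<close>
  then have "real t = of_int \<lfloor>u\<rfloor>" "\<lfloor>u\<rfloor> \<ge> 1" by (simp_all add: t_def)
  then have "t \<ge> 1" "real t \<le> u" "u / 2 \<le> real t" by linarith+
  have "(real t)\<^sup>2 \<le> u\<^sup>2" using \<open>real t \<le> u\<close> by (intro power_mono) auto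
  then have "real (B * t\<^sup>2) \<le> real k"
    using \<open>B > 0\<close> by (simp add: u_def field_simps)
  then have "B * t\<^sup>2 \<le> k" by (simp only: of_nat_le_iff)
  then have "(r + s) * ((r + s + 1) * (r + 2) * t\<^sup>2) \<le> (r + s) * K"
    by (simp only: B_def K mult.assoc)
  then have "(r + s + 1) * (r + 2) * t\<^sup>2 \<le> K"
    using rs by (simp only: nat_mult_le_cancel1 add_pos_pos)
  also have "\<dots> \<le> s * K" using rs by simp
  finally have le: "(r + s + 1) * (r + 2) * t\<^sup>2 \<le> s * K" .
  have "t * (r + s) * (r * t + 2) + (r * t + 2) = (t * (r + s) + 1) * (r * t + 2)"
    by simp
  \<comment> \<open>Since \<open>t \<ge> 1\<close>, the additive constants \<open>1\<close> and
    \<open>2\<close> are at most \<open>t\<close> and \<open>2 * t\<close>.\<close>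
  also have "\<dots> \<le> (t * (r + s + 1)) * ((r + 2) * t)"
    using \<open>t \<ge> 1\<close> by (intro mult_mono) (auto simp: algebra_simps)
  also have "\<dots> = (r + s + 1) * (r + 2) * t\<^sup>2" by (simp add: power2_eq_square algebra_simps)
  also note le
  finally obtain n where n: "n \<ge> r * t * k" "\<not> forces_zero_sum_AP r s k n"
    using not_forces_zero_sum_AP[OF K] \<open>k \<ge> 1\<close> by force
  have "real k powr 1.475 \<le> real k powr (1 + 1 / 2)"
    using \<open>k \<ge> 1\<close> by (intro powr_mono) auto
  also have "\<dots> = real k * sqrt k"
    using \<open>k \<ge> 1\<close> by (subst powr_add) (simp add: powr_half_sqrt)
  finally have "real k powr 1.475 / (2 * sqrt B) \<le> real k * sqrt k / (2 * sqrt B)"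
    by (simp add: divide_right_mono)
  also have "\<dots> = u / 2 * real k" by (simp add: u_def real_sqrt_divide mult.commute)
  also have "\<dots> \<le> real t * real k" using \<open>u / 2 \<le> real t\<close> by (intro mult_right_mono) auto
  also have "\<dots> \<le> real (r * t * k)"
  proof -
    have "t * k \<le> r * (t * k)" using rs by simp
    then have "real (t * k) \<le> real (r * (t * k))" by (simp only: of_nat_le_iff)
    then show ?thesis by (simp add: mult.assoc)
  qed
  also have "\<dots> \<le> real n" using n(1) by (simp only: of_nat_le_iff)
  finally have "ereal (real k powr 1.475 / (2 * sqrt B)) \<le> ereal_of_enat (enat n)" by simp
  also have "\<dots> \<le> ereal_of_enat (M r s k)"
    using M_ge[OF n(2)] by (simp only: ereal_of_enat_le_iff)
  finally show ?thesis .
qed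

lemma M_upper_bound:
  assumes rs: "r > 0" "s > 0" and k: "(r + s) dvd k" and "k > 0"
  shows "ereal_of_enat (M r s k) \<le> ereal (real (r * s) / (real (r + s))\<^sup>2 * (real k)\<^sup>2 + real k)"
proof -
  obtain K where K: "k = (r + s) * K" using k by auto
  then have "K > 0" using \<open>k > 0\<close> by (cases K) auto
  have "M r s k \<le> enat (r * s * K\<^sup>2 + k)"
    using forces_zero_sum_AP_if_large[OF rs K \<open>K > 0\<close>] \<open>k > 0\<close> by (intro M_le) auto
  then have "ereal_of_enat (M r s k) \<le> ereal_of_enat (enat (r * s * K\<^sup>2 + k))"
    by (simp only: ereal_of_enat_le_iff)
  also have "\<dots> = ereal (real (r * s * K\<^sup>2 + k))" by simp
  also have "real (r * s * K\<^sup>2 + k) = real (r * s) / (real (r + s))\<^sup>2 * (real k)\<^sup>2 + real k"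
  proof -
    have "real k = real (r + s) * real K" "real (r + s) \<noteq> 0"
      using rs by (simp_all only: K of_nat_mult)
    then have "real (r * s) / (real (r + s))\<^sup>2 * (real k)\<^sup>2 = real (r * s) * (real K)\<^sup>2"
      by (simp add: power_mult_distrib del: of_nat_add)
    then show ?thesis by simp
  qed
  finally show ?thesis .
qed

theorem theorem1p13:
  fixes r s :: nat
  assumes "r > 0" and "s > 0"
  shows "\<exists>c C :: real. c > 0 \<and> C > 0 \<and>
    (\<forall>\<^sub>F k :: nat in sequentially. (r + s) dvd k \<longrightarrow>
       ereal (c * real k powr 1.475) \<le> ereal_of_enat (M r s k) \<and>
       ereal_of_enat (M r s k) \<le> ereal (real (r * s) / (real (r + s))^2 * (real k)^2 + C * real k))"
proof -
  define B where "B = (r + s) * (r + s + 1) * (r + 2)"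
  have "B > 0" using assms by (simp add: B_def)
  \<comment> \<open>\<open>B\<close> determines \<open>c\<close> and also serves as the threshold
    for \<open>k\<close>; \<open>C = 1\<close> suffices.\<close>
  have bounds: "ereal (1 / (2 * sqrt B) * real k powr 1.475) \<le> ereal_of_enat (M r s k) \<and>
      ereal_of_enat (M r s k) \<le> ereal (real (r * s) / (real (r + s))^2 * (real k)^2 + 1 * real k)"
    if "(r + s) dvd k" "B \<le> k" for k
    using M_lower_bound[OF assms that(1)] M_upper_bound[OF assms that(1)] that(2) \<open>B > 0\<close>
    by (simp add: B_def)
  show ?thesis
  proof (intro exI conjI)
    show "1 / (2 * sqrt B) > 0" using \<open>B > 0\<close> by simp
    show "(1::real) > 0" by simp
    show "\<forall>\<^sub>F k in sequentially. (r + s) dvd k \<longrightarrow>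
        ereal (1 / (2 * sqrt B) * real k powr 1.475) \<le> ereal_of_enat (M r s k) \<and>
        ereal_of_enat (M r s k) \<le> ereal (real (r * s) / (real (r + s))^2 * (real k)^2 + 1 * real k)"
      using eventually_ge_at_top[of B] by eventually_elim (use bounds in blast)
  qed
qed

end
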